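(* There exist positive universal constants $\kappa$ and $C$ (independent of $c$) such that for every $c>1$ there is a continuous function $B:\mathbb R^2\times\mathcal D_c\to\mathbb R$ satisfying the following three conditions: 1. (Initial condition) $B(x,y,w,v)\le 0$ whenever $(w,v)\in\mathcal D_c$ and $|y|\le|x|$. 2. (Majorization property) For all $(x,y,w,v)\in\mathbb R^2\times\mathcal D_c$, $$B(x,y,w,v)\ge \kappa\left(y^2w-C^2c^2x^2v^{-1}\right).$$ 3. (Concavity-type property) For any $(x,y,w,v)\in\mathbb R^2\times\mathcal D_c$ and any $d,e,r,s\in\mathbb R$ with $|e|\le|d|$, the function $$\xi_B(\tau)=B(x+\tau d,\;y+\tau e,\;w+\tau r,\;v+\tau s),$$ defined for those $\tau\in\mathbb R$ for which $(w+\tau r,v+\tau s)\in\mathcal D_c$, is locally concave.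
   Context: For $c\ge1$, $\mathcal D_c=\{(w,v)\in(0,\infty)\times(0,\infty): 1\le wv\le c\}$. "Locally concave" means concave on every interval contained in the set of $\tau$ on which the function is defined. *)

theory Defs
  imports "HOL-Analysis.Analysis"
begin

definition A2_dom :: "real \<Rightarrow> (real \<times> real) set" where
  "A2_dom c = {(w, v). 0 < w \<and> 0 < v \<and> 1 \<le> w * v \<and> w * v \<le> c}"

(* The set T need not be an interval, hence the quantification over subintervals. *)
definition locally_concave_on :: "real set \<Rightarrow> (real \<Rightarrow> real) \<Rightarrow> bool" where
  "locally_concave_on T f \<longleftrightarrow> (\<forall>I. is_interval I \<and> I \<subseteq> T \<longrightarrow> concave_on I f)"

end

theory Submission
  imports Defs
begin

text \<open>
  The function is explicit up to an elementary minimization. Write \<open>n = sqrt (w v / c)\<close>, so that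
  \<open>0 < n \<le> 1\<close>, and consider three functions \<open>P\<close>, \<open>Q\<close>, \<open>K\<close> of \<open>(w, v)\<close>, of sizes \<open>w\<close>, \<open>\<delta> v / c\<^sup>2\<close>
  and \<open>\<delta> n / c\<close> with a small absolute constant \<open>\<delta>\<close>. Then \<open>B (x, y, w, v)\<close> is the minimum over
  real \<open>a1\<close>, \<open>a2\<close>, \<open>b\<close> of
  \<open>P ((y - b)\<^sup>2 + b\<^sup>2) + Q (a1\<^sup>2 + a2\<^sup>2) + 2 K \<bar>a2 b\<bar> - 2 (a1 + a2) x\<close>.
  Dropping the \<open>K\<close> term bounds it below by \<open>P y\<^sup>2 / 2 - 2 x\<^sup>2 / Q\<close>, which is the majorization;
  the choice \<open>a2 = b = 0\<close> bounds it above by \<open>P y\<^sup>2 - x\<^sup>2 / Q\<close>, which is nonpositive for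
  \<open>\<bar>y\<bar> \<le> \<bar>x\<bar>\<close> because \<open>P Q \<le> 1\<close>.

  For concavity along a line, fix a point \<open>t\<close> and minimizing parameters there. Keeping \<open>a2\<close>, \<open>b\<close>
  fixed and moving \<open>a1\<close> at a constant speed \<open>\<kappa>\<close> gives a smooth function that lies above \<open>B\<close> and
  touches it at \<open>t\<close>; a continuous function with such upper supports of nonpositive second derivative
  is concave (\<open>concave_on_if_touched_from_above\<close>). With the best \<open>\<kappa>\<close>, the moving \<open>a1\<close> produces the
  gain \<open>- 2 D\<^sup>2 / Q\<close>, where \<open>D = d - a1 Q'\<close>. The terms to be absorbed are \<open>2 P e\<^sup>2\<close> and
  \<open>4 P' (y - b) e\<close>. Using \<open>\<bar>e\<bar> \<le> \<bar>d\<bar> \<le> \<bar>D\<bar> + \<bar>a1 Q'\<bar>\<close>, everything is dominated by \<open>D\<^sup>2 / Q\<close> and by the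
  negative \<open>P''\<close> and \<open>Q''\<close>, except for the mixed term \<open>\<bar>a1 (y - b) P' Q'\<bar>\<close>. This one is what \<open>K\<close> is
  for: \<open>- K''\<close> dominates \<open>\<bar>P' Q'\<bar>\<close>, and minimality lets \<open>\<bar>a1 (y - b)\<bar>\<close> be replaced by \<open>\<bar>a2 b\<bar>\<close> up to
  harmless errors (\<open>opt_kkt\<close>, \<open>second_variation_nonpos\<close>). The splittings \<open>y = (y - b) + b\<close> and
  \<open>a1 + a2\<close> keep the kinks of \<open>\<bar>a2 b\<bar>\<close> away from the moving variables. That all the needed
  inequalities between \<open>P\<close>, \<open>Q\<close>, \<open>K\<close> and their derivatives hold uniformly in \<open>c\<close>
  is \<open>wt_estimates\<close>.
\<close>

section \<open>Concavity from upper supports\<close>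

text \<open>
  If the graph went below a chord, then \<open>f\<close> minus the chord plus a small concave parabola would have
  a negative interior minimum; a support there would have a local minimum with negative second
  derivative.
\<close>

lemma concave_on_if_touched_from_above:
  fixes f :: "real \<Rightarrow> real"
  assumes I: "is_interval I" and cont: "continuous_on I f"
    and touch: "\<And>t. t \<in> interior I \<Longrightarrow>
      \<exists>g g' g2. g t = f t \<and> g2 \<le> 0 \<and> (g' has_real_derivative g2) (at t) \<and>
        (\<forall>\<^sub>F s in nhds t. f s \<le> g s \<and> (g has_real_derivative g' s) (at s))"
  shows "concave_on I f"
proof -
  have chord: "f ((1 - l) * a + l * b) \<ge> (1 - l) * f a + l * f b"
    if ab: "a \<in> I" "b \<in> I" "a < b" and l: "0 < l" "l < 1" for a b l
  proof (rule ccontr)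
    assume neg: "\<not> ?thesis"
    define m where "m = (1 - l) * a + l * b"
    define \<sigma> where "\<sigma> = (f b - f a) / (b - a)"
    have \<sigma>: "\<sigma> * (b - a) = f b - f a" using ab by (simp add: \<sigma>_def)
    define L where "L s = f a + \<sigma> * (s - a)" for s
    have sub: "{a..b} \<subseteq> I"
      using I ab by (intro connected_contains_Icc) (simp_all add: is_interval_connected_1)
    have ma: "m - a = l * (b - a)" and mb: "b - m = (1 - l) * (b - a)"
      by (simp_all add: m_def algebra_simps)
    have m: "a < m" "m < b"
    proof -
      have "0 < l * (b - a)" "0 < (1 - l) * (b - a)" using l ab by simp_all
      then show "a < m" "m < b" unfolding ma[symmetric] mb[symmetric] by simp_all
    qed
    have "L m = (1 - l) * f a + l * f b"
    proof -
      have "L m = f a + l * (\<sigma> * (b - a))" unfolding L_def ma by (simp add: mult_ac)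
      then show ?thesis unfolding \<sigma> by (simp add: algebra_simps)
    qed
    then have gap: "L m - f m > 0"
      using neg by (simp add: m_def)
    \<comment> \<open>Chosen so that the parabola fills half of the gap at \<open>m\<close>.\<close>
    define \<eta> where "\<eta> = (L m - f m) / (2 * ((m - a) * (b - m)))"
    have pos: "(m - a) * (b - m) > 0"
      using m by simp
    have \<eta>: "\<eta> > 0"
      unfolding \<eta>_def using pos gap by (intro divide_pos_pos mult_pos_pos[of 2]) simp_all
    define h where "h s = f s - L s + \<eta> * ((s - a) * (b - s))" for s
    have "continuous_on {a..b} h"
      unfolding h_def L_def
      by (intro continuous_intros continuous_on_subset[OF cont sub])
    then obtain t where t: "t \<in> {a..b}" and tmin: "\<And>s. s \<in> {a..b} \<Longrightarrow> h t \<le> h s"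
      using continuous_attains_inf[of "{a..b}" h] ab by (auto intro: less_imp_le)
    have ends: "h a = 0" "h b = 0"
      using \<sigma> by (simp_all add: h_def L_def)
    have "\<eta> * ((m - a) * (b - m)) = (L m - f m) / 2"
      using m by (simp add: \<eta>_def)
    then have "h m < 0"
      using gap by (simp add: h_def)
    with tmin[of m] m have "h t < 0" by auto
    with ends t have tab: "a < t" "t < b"
      by (auto simp: less_le)
    have tint: "t \<in> interior I"
      by (rule interiorI[of "{a<..<b}"]) (use tab sub in auto)
    obtain g g' g2 where g: "g t = f t" "g2 \<le> 0" "(g' has_real_derivative g2) (at t)"
      and ev: "\<forall>\<^sub>F s in nhds t. f s \<le> g s \<and> (g has_real_derivative g' s) (at s)"
      using touch[OF tint] by blast
    define k where "k s = g s - L s + \<eta> * ((s - a) * (b - s))" for s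
    define k' where "k' s = g' s - \<sigma> + \<eta> * (a + b - 2 * s)" for s
    have k'': "(k' has_real_derivative (g2 - 2 * \<eta>)) (at t)"
      unfolding k'_def by (auto intro!: derivative_eq_intros g(3))
    have "\<forall>\<^sub>F s in nhds t. s \<in> {a<..<b}"
      using tab by (intro eventually_nhds_in_open) auto
    with ev have "\<forall>\<^sub>F s in nhds t. k t \<le> k s \<and> (k has_real_derivative k' s) (at s)"
    proof eventually_elim
      case (elim s)
      have "k t = h t" by (simp add: k_def h_def g)
      also have "\<dots> \<le> h s" using elim tmin by auto
      also have "\<dots> \<le> k s" using elim by (simp add: k_def h_def)
      finally have "k t \<le> k s" .
      moreover have "(k has_real_derivative k' s) (at s)"
        unfolding k_def k'_def L_def using elim
        by (auto intro!: derivative_eq_intros simp: algebra_simps)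
      ultimately show ?case by blast
    qed
    then obtain \<epsilon> where \<epsilon>: "\<epsilon> > 0"
      and loc: "\<And>s. \<bar>s - t\<bar> < \<epsilon> \<Longrightarrow> k t \<le> k s \<and> (k has_real_derivative k' s) (at s)"
      by (auto simp: eventually_nhds_metric dist_real_def)
    \<comment> \<open>\<open>k\<close> has a critical point at \<open>t\<close> with negative second derivative, so it decreases to the
      right of \<open>t\<close>, against minimality.\<close>
    have k't: "k' t = 0"
      by (rule DERIV_local_min[of k "k' t" t \<epsilon>]) (use \<epsilon> loc in \<open>auto simp: abs_minus_commute\<close>)
    have "g2 - 2 * \<eta> < 0" using g \<eta> by simp
    from DERIV_neg_dec_right[OF k'' this] k't obtain \<rho> where \<rho>: "\<rho> > 0"
      and dec: "\<And>u. 0 < u \<Longrightarrow> u < \<rho> \<Longrightarrow> k' (t + u) < 0" by auto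
    define u where "u = min \<rho> \<epsilon> / 2"
    have u: "0 < u" "u < \<rho>" "u < \<epsilon>" using \<rho> \<epsilon> by (auto simp: u_def)
    have "k (t + u) < k t"
    proof (rule DERIV_neg_imp_decreasing_open[of t "t + u" k])
      show "t < t + u" using u by simp
      fix s assume s: "t < s" "s < t + u"
      show "\<exists>y. (k has_real_derivative y) (at s) \<and> y < 0"
        using loc[of s] dec[of "s - t"] s u by auto
    next
      show "continuous_on {t..t + u} k"
      proof (intro continuous_at_imp_continuous_on ballI)
        fix s assume "s \<in> {t..t + u}"
        then have "(k has_real_derivative k' s) (at s)" using loc[of s] u by auto
        then show "isCont k s" by (rule DERIV_isCont)
      qed
    qed
    with loc[of "t + u"] u show False by auto
  qed
  have "convex I" using I by (simp add: is_interval_convex_1)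
  then show ?thesis
    unfolding concave_on_def
  proof (intro convex_on_linorderI)
    fix l x y :: real
    assume "0 < l" "l < 1" "x \<in> I" "y \<in> I" "x < y"
    then show "- f ((1 - l) *\<^sub>R x + l *\<^sub>R y) \<le> (1 - l) * - f x + l * - f y"
      using chord[of x y l] by simp
  qed
qed

section \<open>The weight functions\<close>

text \<open>The geometric mean of the two weights, normalized to be at most 1 on the domain.\<close>

definition geo :: "real \<Rightarrow> real \<Rightarrow> real \<Rightarrow> real" where
  "geo c w v = sqrt (w * v / c)"

text \<open>
  A function comparable to \<open>w\<close> that is strictly concave along lines: in terms of the relative speeds
  \<open>\<rho> = r / w\<close>, \<open>\<sigma> = s / v\<close>, its second derivative is at most a negative multiple of
  \<open>(n / v) (\<rho>\<^sup>2 + \<sigma>\<^sup>2)\<close>, where \<open>n = geo c w v\<close>. The term \<open>- 2 / v\<close> gives concavity in \<open>\<sigma>\<close> only;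
  the square root term contributes concavity in \<open>\<rho> + \<sigma>\<close>.
\<close>

definition wtP :: "real \<Rightarrow> real \<Rightarrow> real \<Rightarrow> real" where
  "wtP c w v = 4 * w - 2 / v + 2 * geo c w v / v"

text \<open>
  The same function with the weights exchanged, of size \<open>\<delta> v / c\<^sup>2\<close> with \<open>\<delta> = 10^(-6)\<close>; this
  \<open>\<delta>\<close> is small enough for all the numerical inequalities in \<open>wt_estimates\<close>.
\<close>

definition wtQ :: "real \<Rightarrow> real \<Rightarrow> real \<Rightarrow> real" where
  "wtQ c w v = wtP c v w / (10^6 * c\<^sup>2)"

text \<open>
  The coefficient of the mixed term. The square root alone is not strictly concave along
  \<open>r / w = s / v\<close>, and subtracting \<open>w v / c\<close> repairs this. The factor 288 is what makes the negative
  of the second derivative at least four times the absolute product of the first derivatives of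
  \<open>wtP\<close> and \<open>wtQ\<close>.
\<close>

definition wtK :: "real \<Rightarrow> real \<Rightarrow> real \<Rightarrow> real" where
  "wtK c w v = 288 / (10^6 * c) * (3 * geo c w v - (geo c w v)\<^sup>2)"

lemma geo_commute: "geo c w v = geo c v w"
  by (simp add: geo_def mult.commute)

lemma geo_bounds:
  assumes "c > 1" "(w, v) \<in> A2_dom c"
  shows "0 < geo c w v" "geo c w v \<le> 1" "(geo c w v)\<^sup>2 * c = w * v"
  using assms by (auto simp: geo_def A2_dom_def real_sqrt_le_1_iff)

lemma A2_dom_commute: "(w, v) \<in> A2_dom c \<Longrightarrow> (v, w) \<in> A2_dom c"
  by (auto simp: A2_dom_def mult.commute)

lemma wtP_bounds:
  assumes "c > 1" "(w, v) \<in> A2_dom c"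
  shows "2 * w \<le> wtP c w v" "wtP c w v \<le> 4 * w"
proof -
  note g = geo_bounds[OF assms]
  have wv: "w > 0" "v > 0" "1 / v \<le> w"
    using assms by (auto simp: A2_dom_def field_simps)
  have n: "0 \<le> geo c w v / v" "geo c w v / v \<le> 1 / v"
    using g wv by (auto intro: divide_right_mono)
  show "2 * w \<le> wtP c w v" "wtP c w v \<le> 4 * w"
    using n wv by (auto simp: wtP_def)
qed

lemma wtQ_bounds:
  assumes "c > 1" "(w, v) \<in> A2_dom c"
  shows "2 * v / (10^6 * c\<^sup>2) \<le> wtQ c w v" "wtQ c w v \<le> 4 * v / (10^6 * c\<^sup>2)"
  unfolding wtQ_def
  by (intro divide_right_mono wtP_bounds[OF assms(1) A2_dom_commute[OF assms(2)]]; simp)+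

lemma wtK_bounds:
  assumes "c > 1" "(w, v) \<in> A2_dom c"
  shows "0 < wtK c w v" "wtK c w v \<le> 864 / (10^6 * c) * geo c w v"
proof -
  note g = geo_bounds[OF assms]
  have "(geo c w v)\<^sup>2 \<le> geo c w v"
    using g by (simp add: power2_eq_square mult_left_le)
  then show "0 < wtK c w v" 
    unfolding wtK_def using g assms by (intro mult_pos_pos) auto
  have "288 / (10^6 * c) * (3 * geo c w v - (geo c w v)\<^sup>2) \<le> 288 / (10^6 * c) * (3 * geo c w v)"
    using assms by (intro mult_left_mono) auto
  then show "wtK c w v \<le> 864 / (10^6 * c) * geo c w v"
    unfolding wtK_def by simp
qed

lemma geo_has_derivative:
  assumes "c > 0" "W \<tau> > 0" "V \<tau> > 0"
    and W: "(W has_real_derivative r) (at \<tau>)" and V: "(V has_real_derivative s) (at \<tau>)"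
  shows "((\<lambda>\<tau>. geo c (W \<tau>) (V \<tau>)) has_real_derivative
    geo c (W \<tau>) (V \<tau>) * (r / W \<tau> + s / V \<tau>) / 2) (at \<tau>)"
proof -
  have pos: "W \<tau> * V \<tau> / c > 0" using assms by simp
  define n where "n = sqrt (W \<tau> * V \<tau> / c)"
  have n: "n > 0" using pos by (simp add: n_def)
  have nn: "n * n = W \<tau> * V \<tau> / c"
    unfolding n_def using pos by (intro real_sqrt_mult_self[THEN trans] abs_of_pos)
  have "((\<lambda>\<tau>. W \<tau> * V \<tau> / c) has_real_derivative (r * V \<tau> + W \<tau> * s) / c) (at \<tau>)"
    by (rule DERIV_cdivide) (auto intro!: derivative_eq_intros W V)
  then have "((\<lambda>\<tau>. geo c (W \<tau>) (V \<tau>)) has_real_derivative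
      (inverse (sqrt (W \<tau> * V \<tau> / c)) / 2) * ((r * V \<tau> + W \<tau> * s) / c)) (at \<tau>)"
    unfolding geo_def by (rule DERIV_chain2[where f = sqrt and x = \<tau> and g = "\<lambda>\<tau>. W \<tau> * V \<tau> / c", OF DERIV_real_sqrt[OF pos]])
  moreover have "(inverse n / 2) * ((r * V \<tau> + W \<tau> * s) / c) = n * (r / W \<tau> + s / V \<tau>) / 2"
  proof -
    have eq: "r / W \<tau> + s / V \<tau> = ((r * V \<tau> + W \<tau> * s) / c) / (n * n)"
      unfolding nn using assms(1-3) by (simp add: field_simps)
    show ?thesis unfolding eq using n assms(1) by (simp add: field_simps)
  qed
  ultimately show ?thesis
    by (simp only: geo_def n_def)
qed

section \<open>Derivatives of the weight functions along lines\<close>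

text \<open>
  The suffixes 1 and 2 denote the first and second derivatives of \<open>wtP\<close> and \<open>wtK\<close> when \<open>w\<close> and \<open>v\<close>
  move with velocities \<open>r\<close> and \<open>s\<close>.
\<close>

definition wtP1 :: "real \<Rightarrow> real \<Rightarrow> real \<Rightarrow> real \<Rightarrow> real \<Rightarrow> real" where
  "wtP1 c w v r s = 4 * r + 2 * s / v\<^sup>2 + geo c w v / v * (r / w - s / v)"

definition wtP2 :: "real \<Rightarrow> real \<Rightarrow> real \<Rightarrow> real \<Rightarrow> real \<Rightarrow> real" where
  "wtP2 c w v r s = geo c w v / v * (3 / 2 * (s / v)\<^sup>2 - (r / w) * (s / v) - (r / w)\<^sup>2 / 2)
     - 4 * (s / v)\<^sup>2 / v"

definition wtK1 :: "real \<Rightarrow> real \<Rightarrow> real \<Rightarrow> real \<Rightarrow> real \<Rightarrow> real" where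
  "wtK1 c w v r s = 288 / (10^6 * c) * ((3 / 2 * geo c w v - (geo c w v)\<^sup>2) * (r / w + s / v))"

definition wtK2 :: "real \<Rightarrow> real \<Rightarrow> real \<Rightarrow> real \<Rightarrow> real \<Rightarrow> real" where
  "wtK2 c w v r s = 288 / (10^6 * c) * ((3 / 4 * geo c w v - (geo c w v)\<^sup>2) * (r / w + s / v)\<^sup>2
     - (3 / 2 * geo c w v - (geo c w v)\<^sup>2) * ((r / w)\<^sup>2 + (s / v)\<^sup>2))"

lemma wt_derivs:
  assumes "c > 0" "W \<tau> > 0" "V \<tau> > 0"
    and W: "(W has_real_derivative r) (at \<tau>)" and V: "(V has_real_derivative s) (at \<tau>)"
  shows wtP_has_derivative: "((\<lambda>\<tau>. wtP c (W \<tau>) (V \<tau>)) has_real_derivative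
      wtP1 c (W \<tau>) (V \<tau>) r s) (at \<tau>)"
    and wtP1_has_derivative: "((\<lambda>\<tau>. wtP1 c (W \<tau>) (V \<tau>) r s) has_real_derivative
      wtP2 c (W \<tau>) (V \<tau>) r s) (at \<tau>)"
    and wtK_has_derivative: "((\<lambda>\<tau>. wtK c (W \<tau>) (V \<tau>)) has_real_derivative
      wtK1 c (W \<tau>) (V \<tau>) r s) (at \<tau>)"
    and wtK1_has_derivative: "((\<lambda>\<tau>. wtK1 c (W \<tau>) (V \<tau>) r s) has_real_derivative
      wtK2 c (W \<tau>) (V \<tau>) r s) (at \<tau>)"
proof -
  define G where "G = (\<lambda>\<tau>. geo c (W \<tau>) (V \<tau>))"
  have G: "(G has_real_derivative G \<tau> * (r / W \<tau> + s / V \<tau>) / 2) (at \<tau>)"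
    unfolding G_def by (rule geo_has_derivative[OF assms])
  have ne: "W \<tau> \<noteq> 0" "V \<tau> \<noteq> 0" using assms by auto
  have iW: "((\<lambda>\<tau>. r / W \<tau>) has_real_derivative - (r / W \<tau>)\<^sup>2) (at \<tau>)"
    using ne by (auto intro!: derivative_eq_intros W simp: field_simps power2_eq_square)
  have iV: "((\<lambda>\<tau>. s / V \<tau>) has_real_derivative - (s / V \<tau>)\<^sup>2) (at \<tau>)"
    using ne by (auto intro!: derivative_eq_intros V simp: field_simps power2_eq_square)
  have "((\<lambda>\<tau>. G \<tau> / V \<tau>) has_real_derivative
      (G \<tau> * (r / W \<tau> + s / V \<tau>) / 2 * V \<tau> - G \<tau> * s) / (V \<tau> * V \<tau>)) (at \<tau>)"
    by (rule DERIV_divide[OF G V ne(2)])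
  also have "(G \<tau> * (r / W \<tau> + s / V \<tau>) / 2 * V \<tau> - G \<tau> * s) / (V \<tau> * V \<tau>)
      = G \<tau> / V \<tau> * (r / W \<tau> - s / V \<tau>) / 2"
    using ne by (simp add: field_simps)
  finally have GV: "((\<lambda>\<tau>. G \<tau> / V \<tau>) has_real_derivative
      G \<tau> / V \<tau> * (r / W \<tau> - s / V \<tau>) / 2) (at \<tau>)" .
  have V1: "((\<lambda>\<tau>. 2 / V \<tau>) has_real_derivative - (2 * s / (V \<tau>)\<^sup>2)) (at \<tau>)"
    using ne by (auto intro!: derivative_eq_intros V simp: field_simps power2_eq_square)
  have "((\<lambda>\<tau>. 4 * W \<tau> - 2 / V \<tau> + 2 * (G \<tau> / V \<tau>)) has_real_derivative
      4 * r - - (2 * s / (V \<tau>)\<^sup>2) + 2 * (G \<tau> / V \<tau> * (r / W \<tau> - s / V \<tau>) / 2)) (at \<tau>)"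
    by (intro DERIV_add DERIV_diff DERIV_cmult W V1 GV)
  then show "((\<lambda>\<tau>. wtP c (W \<tau>) (V \<tau>)) has_real_derivative wtP1 c (W \<tau>) (V \<tau>) r s) (at \<tau>)"
    by (simp add: wtP_def wtP1_def G_def)
  have V2: "((\<lambda>\<tau>. 2 * s / (V \<tau>)\<^sup>2) has_real_derivative - (4 * (s / V \<tau>)\<^sup>2 / V \<tau>)) (at \<tau>)"
    using ne by (auto intro!: derivative_eq_intros V simp: field_simps power2_eq_square)
  have "((\<lambda>\<tau>. 4 * r + 2 * s / (V \<tau>)\<^sup>2 + G \<tau> / V \<tau> * (r / W \<tau> - s / V \<tau>)) has_real_derivative
      0 + - (4 * (s / V \<tau>)\<^sup>2 / V \<tau>) + (G \<tau> / V \<tau> * (r / W \<tau> - s / V \<tau>) / 2 * (r / W \<tau> - s / V \<tau>)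
      + (- (r / W \<tau>)\<^sup>2 - - (s / V \<tau>)\<^sup>2) * (G \<tau> / V \<tau>))) (at \<tau>)"
    by (intro DERIV_add DERIV_mult DERIV_diff DERIV_const V2 GV iW iV)
  also have "0 + - (4 * (s / V \<tau>)\<^sup>2 / V \<tau>) + (G \<tau> / V \<tau> * (r / W \<tau> - s / V \<tau>) / 2 * (r / W \<tau> - s / V \<tau>)
      + (- (r / W \<tau>)\<^sup>2 - - (s / V \<tau>)\<^sup>2) * (G \<tau> / V \<tau>)) = wtP2 c (W \<tau>) (V \<tau>) r s"
  proof -
    have "0 + - (4 * b\<^sup>2 / z) + (g * (a - b) / 2 * (a - b) + (- a\<^sup>2 - - b\<^sup>2) * g)
       = g * (3 / 2 * b\<^sup>2 - a * b - a\<^sup>2 / 2) - 4 * b\<^sup>2 / z" for a b g z :: real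
      by (simp add: power2_eq_square field_simps)
    then show ?thesis unfolding wtP2_def G_def by metis
  qed
  finally show "((\<lambda>\<tau>. wtP1 c (W \<tau>) (V \<tau>) r s) has_real_derivative wtP2 c (W \<tau>) (V \<tau>) r s) (at \<tau>)"
    by (simp add: wtP1_def G_def)
  have G2: "((\<lambda>\<tau>. (G \<tau>)\<^sup>2) has_real_derivative (G \<tau>)\<^sup>2 * (r / W \<tau> + s / V \<tau>)) (at \<tau>)"
    using DERIV_mult[OF G G] by (simp add: power2_eq_square algebra_simps)
  have "((\<lambda>\<tau>. 288 / (10^6 * c) * (3 * G \<tau> - (G \<tau>)\<^sup>2)) has_real_derivative
      288 / (10^6 * c) * (3 * (G \<tau> * (r / W \<tau> + s / V \<tau>) / 2) - (G \<tau>)\<^sup>2 * (r / W \<tau> + s / V \<tau>))) (at \<tau>)"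
    by (intro DERIV_cmult DERIV_diff G G2)
  then show "((\<lambda>\<tau>. wtK c (W \<tau>) (V \<tau>)) has_real_derivative wtK1 c (W \<tau>) (V \<tau>) r s) (at \<tau>)"
    by (simp add: wtK_def wtK1_def G_def algebra_simps)
  have "((\<lambda>\<tau>. 288 / (10^6 * c) * ((3 / 2 * G \<tau> - (G \<tau>)\<^sup>2) * (r / W \<tau> + s / V \<tau>))) has_real_derivative
      288 / (10^6 * c) * ((3 / 2 * (G \<tau> * (r / W \<tau> + s / V \<tau>) / 2) - (G \<tau>)\<^sup>2 * (r / W \<tau> + s / V \<tau>))
        * (r / W \<tau> + s / V \<tau>)
       + (- (r / W \<tau>)\<^sup>2 + - (s / V \<tau>)\<^sup>2) * (3 / 2 * G \<tau> - (G \<tau>)\<^sup>2))) (at \<tau>)"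
    by (intro DERIV_cmult DERIV_mult DERIV_add DERIV_diff G G2 iW iV)
  also have "288 / (10^6 * c) * ((3 / 2 * (G \<tau> * (r / W \<tau> + s / V \<tau>) / 2) - (G \<tau>)\<^sup>2 * (r / W \<tau> + s / V \<tau>))
        * (r / W \<tau> + s / V \<tau>)
       + (- (r / W \<tau>)\<^sup>2 + - (s / V \<tau>)\<^sup>2) * (3 / 2 * G \<tau> - (G \<tau>)\<^sup>2)) = wtK2 c (W \<tau>) (V \<tau>) r s"
  proof -
    have "k * ((3 / 2 * (g * (a + b) / 2) - g\<^sup>2 * (a + b)) * (a + b)
        + (- a\<^sup>2 + - b\<^sup>2) * (3 / 2 * g - g\<^sup>2))
       = k * ((3 / 4 * g - g\<^sup>2) * (a + b)\<^sup>2 - (3 / 2 * g - g\<^sup>2) * (a\<^sup>2 + b\<^sup>2))" for a b g k :: real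
      by (simp add: power2_eq_square field_simps)
    then show ?thesis unfolding wtK2_def G_def by metis
  qed
  finally show "((\<lambda>\<tau>. wtK1 c (W \<tau>) (V \<tau>) r s) has_real_derivative wtK2 c (W \<tau>) (V \<tau>) r s) (at \<tau>)"
    by (simp add: wtK1_def G_def)
qed

lemma wt_second_derivative_bounds:
  fixes c w v r s :: real
  assumes "c > 1" "(w, v) \<in> A2_dom c"
  defines "S \<equiv> (r / w)\<^sup>2 + (s / v)\<^sup>2"
  shows "wtP2 c w v r s \<le> - (geo c w v / v * S / 4)"
    and "wtK2 c w v r s \<le> - (144 / (10^6 * c) * (geo c w v)\<^sup>2 * S)"
proof -
  define a b n where "a = r / w" and "b = s / v" and "n = geo c w v"
  note g = geo_bounds[OF assms(1,2), folded n_def]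
  have v: "v > 0" using assms by (auto simp: A2_dom_def)
  have nv: "n / v \<le> 1 / v" "0 < n / v" using g v by (auto intro: divide_right_mono)
  \<comment> \<open>Since \<open>n \<le> 1\<close>, part of the term \<open>- 4 b\<^sup>2 / v\<close> makes the quadratic form definite.\<close>
  have "n / v * (3 / 2 * b\<^sup>2 - a * b - a\<^sup>2 / 2) - 4 * b\<^sup>2 * (1 / v)
     \<le> n / v * (3 / 2 * b\<^sup>2 - a * b - a\<^sup>2 / 2) - 4 * b\<^sup>2 * (n / v)"
    using nv by (intro diff_left_mono mult_left_mono) auto
  also have "\<dots> = - (n / v * (a\<^sup>2 + b\<^sup>2) / 4) - n / v * ((a / 2 + b)\<^sup>2 + 5 / 4 * b\<^sup>2)"
    by (simp add: power2_eq_square algebra_simps add_divide_distrib)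
  also have "\<dots> \<le> - (n / v * (a\<^sup>2 + b\<^sup>2) / 4)"
  proof -
    have "0 \<le> n / v * ((a / 2 + b)\<^sup>2 + 5 / 4 * b\<^sup>2)"
      using nv by (intro mult_nonneg_nonneg) auto
    then show ?thesis by linarith
  qed
  finally show "wtP2 c w v r s \<le> - (geo c w v / v * S / 4)"
    unfolding wtP2_def S_def a_def b_def n_def by simp
  have n2: "n\<^sup>2 \<le> n" using g by (simp add: power2_eq_square mult_left_le)
  have "(3 / 4 * n - n\<^sup>2) * (a + b)\<^sup>2 - (3 / 2 * n - n\<^sup>2) * (a\<^sup>2 + b\<^sup>2)
     = - (3 / 4 * n * (a - b)\<^sup>2) - 2 * n\<^sup>2 * a * b"
    by (simp add: power2_eq_square algebra_simps)
  also have "\<dots> \<le> - (3 / 4 * n\<^sup>2 * (a - b)\<^sup>2) - 2 * n\<^sup>2 * a * b"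
    using n2 by (simp add: mult_right_mono)
  also have "\<dots> = - (n\<^sup>2 * (a\<^sup>2 + b\<^sup>2) / 2) - n\<^sup>2 * (a + b)\<^sup>2 / 4"
    by (simp add: power2_eq_square algebra_simps add_divide_distrib)
  also have "\<dots> \<le> - (n\<^sup>2 * (a\<^sup>2 + b\<^sup>2) / 2)" by simp
  finally have "288 / (10^6 * c) * ((3 / 4 * n - n\<^sup>2) * (a + b)\<^sup>2 - (3 / 2 * n - n\<^sup>2) * (a\<^sup>2 + b\<^sup>2))
     \<le> 288 / (10^6 * c) * - (n\<^sup>2 * (a\<^sup>2 + b\<^sup>2) / 2)"
    using assms by (intro mult_left_mono) auto
  then show "wtK2 c w v r s \<le> - (144 / (10^6 * c) * (geo c w v)\<^sup>2 * S)"
    unfolding wtK2_def S_def a_def b_def n_def by simp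
qed

lemma wtP1_bound:
  assumes "c > 1" "(w, v) \<in> A2_dom c"
  shows "(wtP1 c w v r s)\<^sup>2 \<le> 36 * w\<^sup>2 * ((r / w)\<^sup>2 + (s / v)\<^sup>2)"
proof -
  define a b n where "a = r / w" and "b = s / v" and "n = geo c w v"
  note g = geo_bounds[OF assms, folded n_def]
  have wv: "w > 0" "v > 0" "1 / v \<le> w" using assms by (auto simp: A2_dom_def field_simps)
  have "n / v \<le> 1 / v" using g wv by (intro divide_right_mono) auto
  then have nv: "n / v \<le> w" "0 < n / v" "0 < 1 / v" "n / v \<le> 1 / v"
    using g wv by auto
  have eq: "wtP1 c w v r s = (4 * w + n / v) * a + (2 * (1 / v) - n / v) * b"
    using wv by (simp add: wtP1_def a_def b_def n_def power2_eq_square field_simps)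
  have "\<bar>(4 * w + n / v) * a\<bar> \<le> 5 * w * \<bar>a\<bar>"
    unfolding abs_mult using nv wv by (intro mult_right_mono) auto
  moreover have "\<bar>(2 * (1 / v) - n / v) * b\<bar> \<le> 3 * w * \<bar>b\<bar>"
    unfolding abs_mult using nv wv by (intro mult_right_mono) (auto simp: abs_le_iff)
  ultimately have "\<bar>wtP1 c w v r s\<bar> \<le> 5 * w * \<bar>a\<bar> + 3 * w * \<bar>b\<bar>"
    unfolding eq
    using abs_triangle_ineq[of "(4 * w + n / v) * a" "(2 * (1 / v) - n / v) * b"] by linarith
  then have "\<bar>wtP1 c w v r s\<bar>\<^sup>2 \<le> (5 * w * \<bar>a\<bar> + 3 * w * \<bar>b\<bar>)\<^sup>2"
    by (intro power_mono) auto
  also have "\<dots> \<le> 36 * w\<^sup>2 * (a\<^sup>2 + b\<^sup>2)"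
  proof -
    have "36 * w\<^sup>2 * (a\<^sup>2 + b\<^sup>2) - (5 * w * \<bar>a\<bar> + 3 * w * \<bar>b\<bar>)\<^sup>2
        = (3 * (w * \<bar>a\<bar>) - 5 * (w * \<bar>b\<bar>))\<^sup>2 + 2 * (w * \<bar>a\<bar>)\<^sup>2 + 2 * (w * \<bar>b\<bar>)\<^sup>2"
      by (simp add: power2_eq_square algebra_simps)
    then show ?thesis by (smt (verit) zero_le_power2)
  qed
  finally show ?thesis by (simp add: a_def b_def)
qed

text \<open>
  All relations between the weight functions that the second variation needs. Each reduces, after
  substituting the size bounds, to a numerical inequality between powers of \<open>n = geo c w v \<le> 1\<close>,
  through the identity \<open>w v = n\<^sup>2 c\<close>.
\<close>

lemma wt_estimates:
  fixes c w v r s :: real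
  assumes c: "c > 1" and dom: "(w, v) \<in> A2_dom c"
  defines "p \<equiv> wtP c w v" and "q \<equiv> wtQ c w v" and "k \<equiv> wtK c w v"
    and "p1 \<equiv> wtP1 c w v r s" and "q1 \<equiv> wtP1 c v w s r / (10^6 * c\<^sup>2)"
    and "p2 \<equiv> wtP2 c w v r s" and "q2 \<equiv> wtP2 c v w s r / (10^6 * c\<^sup>2)"
    and "k2 \<equiv> wtK2 c w v r s"
  shows "k\<^sup>2 \<le> p * q" "p * q \<le> 1 / 8"
    "4 * p * q1\<^sup>2 \<le> - q2" "4 * q * p1\<^sup>2 \<le> - p2" "4 * \<bar>p1 * q1\<bar> \<le> - k2"
    "4 * k * \<bar>p1 * q1\<bar> \<le> - p2 * q" "4 * k * \<bar>p1 * q1\<bar> \<le> - q2 * p"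
proof -
  define n where "n = geo c w v"
  define S where "S = (r / w)\<^sup>2 + (s / v)\<^sup>2"
  define D u where "D = 1 / (10^6 * c\<^sup>2)" and "u = 1 / (10^6 * c)"
  have dom': "(v, w) \<in> A2_dom c" by (rule A2_dom_commute[OF dom])
  have n: "0 < n" "n \<le> 1" "w * v = n\<^sup>2 * c"
    using geo_bounds[OF c dom] by (auto simp: n_def)
  have wv: "w > 0" "v > 0" using dom by (auto simp: A2_dom_def)
  have S: "S \<ge> 0" by (simp add: S_def)
  have uD: "u > 0" "D > 0" "u * c = 1 / 10^6" "D * c = u" "u \<le> 1 / 10^6"
    using c by (auto simp: u_def D_def field_simps power2_eq_square)
  have wvD: "w * v * D = n\<^sup>2 * u"
    using uD(4) n(3) by (simp add: mult.assoc mult.commute)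
  have p: "2 * w \<le> p" "p \<le> 4 * w" using wtP_bounds[OF c dom] by (auto simp: p_def)
  have q: "2 * v * D \<le> q" "q \<le> 4 * v * D"
    using wtQ_bounds[OF c dom] by (auto simp: q_def D_def)
  have k: "0 \<le> k" "k \<le> 864 * u * n"
    using wtK_bounds[OF c dom] by (auto simp: k_def u_def n_def)
  have p0: "p > 0" using p wv by linarith
  have q0: "q > 0" using q wv uD mult_pos_pos[of v D] by linarith
  have p1: "p1\<^sup>2 \<le> 36 * w\<^sup>2 * S"
    using wtP1_bound[OF c dom] by (simp add: p1_def S_def)
  have q1: "q1\<^sup>2 \<le> 36 * (v * D)\<^sup>2 * S"
  proof -
    have "q1\<^sup>2 = D\<^sup>2 * (wtP1 c v w s r)\<^sup>2"
      by (simp add: q1_def D_def power_divide)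
    also have "\<dots> \<le> D\<^sup>2 * (36 * v\<^sup>2 * S)"
      using wtP1_bound[OF c dom', of s r] by (intro mult_left_mono) (auto simp: S_def add.commute)
    finally show ?thesis by (simp add: power_mult_distrib mult_ac)
  qed
  have p2: "n / v * S / 4 \<le> - p2"
    using wt_second_derivative_bounds(1)[OF c dom, of r s] by (simp add: p2_def n_def S_def)
  have q2: "D * (n / w * S / 4) \<le> - q2"
  proof -
    have "D * (n / w * S / 4) \<le> D * - wtP2 c v w s r"
      using wt_second_derivative_bounds(1)[OF c dom', of s r] uD
      by (intro mult_left_mono) (auto simp: n_def S_def add.commute geo_commute)
    then show ?thesis by (simp add: q2_def D_def)
  qed
  have k2: "144 * u * n\<^sup>2 * S \<le> - k2"
    using wt_second_derivative_bounds(2)[OF c dom, of r s] by (simp add: k2_def n_def S_def u_def)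
  have X: "\<bar>p1 * q1\<bar> \<le> 36 * n\<^sup>2 * u * S"
  proof (rule power2_le_imp_le)
    have "\<bar>p1 * q1\<bar>\<^sup>2 = p1\<^sup>2 * q1\<^sup>2" by (simp add: power_mult_distrib)
    also have "\<dots> \<le> (36 * w\<^sup>2 * S) * (36 * (v * D)\<^sup>2 * S)"
      using p1 q1 S by (intro mult_mono) auto
    also have "\<dots> = (36 * (w * v * D) * S)\<^sup>2"
      by (simp add: power2_eq_square)
    also have "\<dots> = (36 * n\<^sup>2 * u * S)\<^sup>2"
      unfolding wvD by (simp add: mult.assoc)
    finally show "\<bar>p1 * q1\<bar>\<^sup>2 \<le> (36 * n\<^sup>2 * u * S)\<^sup>2" .
    show "0 \<le> 36 * n\<^sup>2 * u * S" using S uD by simp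
  qed
  have pq: "4 * (n\<^sup>2 * u) \<le> p * q" "p * q \<le> 16 * (n\<^sup>2 * u)"
  proof -
    have "(2 * w) * (2 * v * D) \<le> p * q" "p * q \<le> (4 * w) * (4 * v * D)"
      using p q p0 q0 wv uD by (intro mult_mono; simp)+
    moreover have "(2 * w) * (2 * v * D) = 4 * (w * v * D)" "(4 * w) * (4 * v * D) = 16 * (w * v * D)"
      by simp_all
    ultimately show "4 * (n\<^sup>2 * u) \<le> p * q" "p * q \<le> 16 * (n\<^sup>2 * u)"
      unfolding wvD by simp_all
  qed
  have n2: "n\<^sup>2 \<le> 1" using n by (simp add: power_le_one)
  have "n\<^sup>2 * u \<le> 1 * (1 / 10^6)" using n2 uD by (intro mult_mono) auto
  with pq(2) show "p * q \<le> 1 / 8" by simp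
  have "k\<^sup>2 \<le> (864 * u * n)\<^sup>2" using k by (intro power_mono)
  also have "\<dots> = 746496 * u * (n\<^sup>2 * u)" by (simp add: power2_eq_square)
  also have "\<dots> \<le> 4 * (n\<^sup>2 * u)" using uD by (intro mult_right_mono) auto
  finally show "k\<^sup>2 \<le> p * q" using pq by linarith
  have "4 * \<bar>p1 * q1\<bar> \<le> 144 * u * n\<^sup>2 * S" using X by (simp add: mult_ac)
  then show "4 * \<bar>p1 * q1\<bar> \<le> - k2" using k2 by linarith
  have w2v2: "w\<^sup>2 * v\<^sup>2 * D = n^4 / 10^6"
  proof -
    have "w\<^sup>2 * v\<^sup>2 * D = (w * v) * (w * v * D)" by (simp add: power2_eq_square)
    also have "\<dots> = n\<^sup>2 * c * (n\<^sup>2 * u)" unfolding wvD by (simp add: n(3))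
    also have "\<dots> = n^4 * (u * c)" by (simp add: power2_eq_square power4_eq_xxxx)
    finally show ?thesis by (simp add: uD(3))
  qed
  have "n^4 \<le> n^1" using n by (intro power_decreasing) auto
  then have key: "2304 * (w\<^sup>2 * v\<^sup>2 * D) \<le> n" using n(1) unfolding w2v2 by simp
  have "4 * p * q1\<^sup>2 \<le> 4 * (4 * w) * (36 * (v * D)\<^sup>2 * S)"
    using p q1 p0 S by (intro mult_mono) auto
  also have "\<dots> = 2304 * (w\<^sup>2 * v\<^sup>2 * D) * (D * S / (4 * w))"
    using wv by (simp add: power2_eq_square field_simps)
  also have "\<dots> \<le> n * (D * S / (4 * w))"
    using key S uD wv by (intro mult_right_mono) auto
  also have "\<dots> = D * (n / w * S / 4)" using wv by (simp add: field_simps)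
  finally show "4 * p * q1\<^sup>2 \<le> - q2" using q2 by linarith
  have "4 * q * p1\<^sup>2 \<le> 4 * (4 * v * D) * (36 * w\<^sup>2 * S)"
    using q p1 q0 S by (intro mult_mono) auto
  also have "\<dots> = 2304 * (w\<^sup>2 * v\<^sup>2 * D) * (S / (4 * v))"
    using wv by (simp add: power2_eq_square field_simps)
  also have "\<dots> \<le> n * (S / (4 * v))"
    using key S wv by (intro mult_right_mono) auto
  also have "\<dots> = n / v * S / 4" by simp
  finally show "4 * q * p1\<^sup>2 \<le> - p2" using p2 by linarith
  have "4 * k * \<bar>p1 * q1\<bar> \<le> 4 * (864 * u * n) * (36 * n\<^sup>2 * u * S)"
    using k X uD n by (intro mult_mono) auto
  also have "\<dots> = 124416 * (u * c) * n\<^sup>2 * (n * S * D)"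
    unfolding uD(4)[symmetric] by (simp add: power2_eq_square)
  also have "\<dots> \<le> 1 / 2 * 1 * (n * S * D)"
    using n n2 S uD by (intro mult_right_mono mult_mono) auto
  finally have kX: "4 * k * \<bar>p1 * q1\<bar> \<le> n * S * D / 2" by simp
  have "n * S * D / 2 = (n / v * S / 4) * (2 * v * D)" using wv by simp
  also have "\<dots> \<le> - p2 * q"
    using p2 q n S wv uD order_trans[OF _ p2, of 0] by (intro mult_mono) simp_all
  finally show "4 * k * \<bar>p1 * q1\<bar> \<le> - p2 * q" using kX by linarith
  have "n * S * D / 2 = (D * (n / w * S / 4)) * (2 * w)" using wv by simp
  also have "\<dots> \<le> - q2 * p"
    using q2 p n S wv uD order_trans[OF _ q2, of 0] by (intro mult_mono) simp_all
  finally show "4 * k * \<bar>p1 * q1\<bar> \<le> - q2 * p" using kX by linarith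
qed

section \<open>The second variation\<close>

text \<open>
  Here \<open>b1\<close> stands for \<open>y - b\<close> and \<open>b2\<close> for \<open>b\<close>; the expression is the second derivative at \<open>t\<close> of the
  upper support described above. The hypotheses on \<open>\<bar>b1\<bar>\<close> and \<open>\<bar>a1\<bar>\<close> come from the optimality of
  \<open>b\<close> and \<open>a2\<close>.
\<close>

lemma second_variation_nonpos:
  fixes p q k :: real
  assumes pos: "p > 0" "q > 0" "k \<ge> 0" and pq: "p * q \<le> 1 / 8"
    and Q: "4 * p * q1\<^sup>2 \<le> - q2" and P: "4 * q * p1\<^sup>2 \<le> - p2" and K: "4 * \<bar>p1 * q1\<bar> \<le> - k2"
    and kP: "4 * k * \<bar>p1 * q1\<bar> \<le> - p2 * q" and kQ: "4 * k * \<bar>p1 * q1\<bar> \<le> - q2 * p"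
    and b1: "p * \<bar>b1\<bar> \<le> p * \<bar>b2\<bar> + k * \<bar>a2\<bar>" and a1: "q * \<bar>a1\<bar> \<le> q * \<bar>a2\<bar> + k * \<bar>b2\<bar>"
    and kpq: "k\<^sup>2 \<le> p * q" and ed: "\<bar>e\<bar> \<le> \<bar>d\<bar>"
  defines "\<kappa> \<equiv> (d - a1 * q1) / q"
  shows "p2 * (b1\<^sup>2 + b2\<^sup>2) + 4 * p1 * b1 * e + 2 * p * e\<^sup>2
    + q2 * (a1\<^sup>2 + a2\<^sup>2) + 4 * q1 * a1 * \<kappa> + 2 * q * \<kappa>\<^sup>2
    + 2 * k2 * \<bar>a2 * b2\<bar> - 4 * \<kappa> * d \<le> 0"
proof -
  define D X where "D = d - a1 * q1" and "X = \<bar>p1 * q1\<bar>"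
  have X: "X \<ge> 0" by (simp add: X_def)
  \<comment> \<open>\<open>\<kappa>\<close> is the minimizer of this quadratic polynomial.\<close>
  have \<kappa>: "4 * q1 * a1 * \<kappa> + 2 * q * \<kappa>\<^sup>2 - 4 * \<kappa> * d = - 2 * (D\<^sup>2 / q)"
  proof -
    have "q * \<kappa> = D" using pos by (simp add: \<kappa>_def D_def)
    moreover have "4 * q1 * a1 * \<kappa> + 2 * q * \<kappa>\<^sup>2 - 4 * \<kappa> * d = 2 * \<kappa> * (q * \<kappa>) - 4 * \<kappa> * D"
      by (simp add: D_def power2_eq_square algebra_simps)
    ultimately have "4 * q1 * a1 * \<kappa> + 2 * q * \<kappa>\<^sup>2 - 4 * \<kappa> * d = - 2 * (\<kappa> * D)" by simp
    also have "\<kappa> * D = D\<^sup>2 / q" by (simp add: \<kappa>_def D_def power2_eq_square)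
    finally show ?thesis .
  qed
  have "d\<^sup>2 \<le> 2 * D\<^sup>2 + 2 * (a1 * q1)\<^sup>2"
  proof -
    have "2 * D\<^sup>2 + 2 * (a1 * q1)\<^sup>2 - d\<^sup>2 = (D - a1 * q1)\<^sup>2"
      by (simp add: D_def power2_eq_square algebra_simps)
    then show ?thesis by (smt (verit) zero_le_power2)
  qed
  moreover have "e\<^sup>2 \<le> d\<^sup>2" using ed by (simp add: abs_le_square_iff)
  ultimately have "p * e\<^sup>2 \<le> p * (2 * D\<^sup>2 + 2 * (a1 * q1)\<^sup>2)"
    using pos by (intro mult_left_mono) auto
  moreover have "2 * p * D\<^sup>2 \<le> D\<^sup>2 / q / 4"
  proof -
    have "8 * (p * q) * D\<^sup>2 \<le> 1 * D\<^sup>2" using pq by (intro mult_right_mono) auto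
    then show ?thesis using pos by (simp add: field_simps)
  qed
  moreover have "a1\<^sup>2 * (4 * p * q1\<^sup>2) \<le> a1\<^sup>2 * - q2" using Q by (intro mult_left_mono) auto
  ultimately have T1: "2 * p * e\<^sup>2 \<le> D\<^sup>2 / q / 2 - a1\<^sup>2 * q2"
    by (simp add: algebra_simps power_mult_distrib)
  have "b1 * p1 * e \<le> \<bar>b1 * p1\<bar> * \<bar>e\<bar>" by (metis abs_ge_self abs_mult)
  also have "\<dots> \<le> \<bar>b1 * p1\<bar> * \<bar>d\<bar>" using ed by (intro mult_left_mono) auto
  also have "\<dots> \<le> \<bar>b1 * p1\<bar> * (\<bar>D\<bar> + \<bar>a1 * q1\<bar>)"
    by (intro mult_left_mono) (auto simp: D_def)
  also have "\<dots> = \<bar>b1 * p1\<bar> * \<bar>D\<bar> + \<bar>a1 * b1\<bar> * X"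
    by (simp add: X_def abs_mult algebra_simps)
  finally have T2: "4 * (b1 * p1 * e) \<le> 4 * (\<bar>b1 * p1\<bar> * \<bar>D\<bar>) + 4 * (\<bar>a1 * b1\<bar> * X)" by simp
  have T3: "4 * (\<bar>b1 * p1\<bar> * \<bar>D\<bar>) \<le> D\<^sup>2 / q - b1\<^sup>2 * p2"
  proof -
    have "0 \<le> (\<bar>D\<bar> - 2 * q * \<bar>b1 * p1\<bar>)\<^sup>2 / q" using pos by simp
    also have "\<dots> = D\<^sup>2 / q - 4 * (\<bar>b1 * p1\<bar> * \<bar>D\<bar>) + 4 * q * (b1 * p1)\<^sup>2"
      using pos by (simp add: power2_diff diff_divide_distrib add_divide_distrib power_mult_distrib)
         (simp add: power2_eq_square field_simps)
    finally have "4 * (\<bar>b1 * p1\<bar> * \<bar>D\<bar>) \<le> D\<^sup>2 / q + b1\<^sup>2 * (4 * q * p1\<^sup>2)"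
      by (simp add: power_mult_distrib algebra_simps)
    moreover have "b1\<^sup>2 * (4 * q * p1\<^sup>2) \<le> b1\<^sup>2 * - p2" using P by (intro mult_left_mono) auto
    ultimately show ?thesis by simp
  qed
  have T4: "4 * (\<bar>a1 * b1\<bar> * X) \<le> - 2 * k2 * \<bar>a2 * b2\<bar> - p2 * b2\<^sup>2 - q2 * a2\<^sup>2"
  proof -
    define A B where "A = \<bar>a2\<bar>" and "B = \<bar>b2\<bar>"
    have AB: "A \<ge> 0" "B \<ge> 0" by (auto simp: A_def B_def)
    have "(p * \<bar>b1\<bar>) * (q * \<bar>a1\<bar>) \<le> (p * B + k * A) * (q * A + k * B)"
      using b1 a1 pos AB by (intro mult_mono) (auto simp: A_def B_def)
    also have "\<dots> = (p * q + k\<^sup>2) * (A * B) + p * k * B\<^sup>2 + q * k * A\<^sup>2"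
      by (simp add: power2_eq_square algebra_simps)
    also have "\<dots> \<le> (2 * (p * q)) * (A * B) + p * k * B\<^sup>2 + q * k * A\<^sup>2"
      using kpq AB by (intro add_right_mono mult_right_mono) auto
    finally have "(p * \<bar>b1\<bar>) * (q * \<bar>a1\<bar>) * (4 * X)
        \<le> ((2 * (p * q)) * (A * B) + p * k * B\<^sup>2 + q * k * A\<^sup>2) * (4 * X)"
      using X by (intro mult_right_mono) auto
    also have "\<dots> = 2 * (p * q) * (A * B) * (4 * X) + p * B\<^sup>2 * (4 * k * X) + q * A\<^sup>2 * (4 * k * X)"
      by (simp add: algebra_simps)
    also have "\<dots> \<le> 2 * (p * q) * (A * B) * - k2 + p * B\<^sup>2 * (- p2 * q) + q * A\<^sup>2 * (- q2 * p)"
      using K kP kQ AB pos unfolding X_def by (intro add_mono mult_left_mono) auto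
    finally have "(p * q) * (4 * (\<bar>a1 * b1\<bar> * X))
        \<le> (p * q) * (- 2 * k2 * (A * B) - p2 * B\<^sup>2 - q2 * A\<^sup>2)"
      by (simp add: abs_mult algebra_simps)
    then have "4 * (\<bar>a1 * b1\<bar> * X) \<le> - 2 * k2 * (A * B) - p2 * B\<^sup>2 - q2 * A\<^sup>2"
      using pos by (simp add: mult_le_cancel_left_pos)
    then show ?thesis by (simp add: A_def B_def abs_mult)
  qed
  have "0 \<le> D\<^sup>2 / q" using pos by simp
  with \<kappa> T1 T2 T3 T4 show ?thesis by (simp add: algebra_simps)
qed

section \<open>The minimization problem\<close>

text \<open>The function of the parameters \<open>a1\<close>, \<open>a2\<close>, \<open>b\<close> to be minimized.\<close>

definition trial :: "real \<Rightarrow> real \<Rightarrow> real \<Rightarrow> real \<Rightarrow> real \<Rightarrow> real \<Rightarrow> real \<Rightarrow> real \<Rightarrow> real" where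
  "trial p q k x y a1 a2 b =
     p * ((y - b)\<^sup>2 + b\<^sup>2) + q * (a1\<^sup>2 + a2\<^sup>2) + 2 * k * \<bar>a2 * b\<bar> - 2 * (a1 + a2) * x"

text \<open>
  The absolute values of the minimizing \<open>a2\<close> and \<open>b\<close>. For \<open>x, y \<ge> 0\<close> they are the
  solution of the linear system \<open>2 p \<beta> + k \<alpha> = p y\<close>, \<open>q \<alpha> + k \<beta> = x\<close>, clipped to
  \<open>[0, x / q]\<close> and \<open>[0, y / 2]\<close>; the clipping accounts for the cases in which the minimum lies on a
  kink of \<open>\<bar>a2 b\<bar>\<close>.
\<close>

definition opt_a :: "real \<Rightarrow> real \<Rightarrow> real \<Rightarrow> real \<Rightarrow> real \<Rightarrow> real" where
  "opt_a p q k x y = max 0 (min (\<bar>x\<bar> / q) (p * (2 * \<bar>x\<bar> - k * \<bar>y\<bar>) / (2 * p * q - k\<^sup>2)))"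

definition opt_b :: "real \<Rightarrow> real \<Rightarrow> real \<Rightarrow> real \<Rightarrow> real \<Rightarrow> real" where
  "opt_b p q k x y = max 0 (min (\<bar>y\<bar> / 2) ((p * q * \<bar>y\<bar> - k * \<bar>x\<bar>) / (2 * p * q - k\<^sup>2)))"

text \<open>
  The minimum in closed form, which makes its continuity evident; the next lemmas show that it is a
  lower bound of \<open>trial\<close> and is attained.
\<close>

definition trial_min :: "real \<Rightarrow> real \<Rightarrow> real \<Rightarrow> real \<Rightarrow> real \<Rightarrow> real" where
  "trial_min p q k x y = p * y\<^sup>2 - x\<^sup>2 / q - p * \<bar>y\<bar> * opt_b p q k x y - \<bar>x\<bar> * opt_a p q k x y"

text \<open>
  The Karush-Kuhn-Tucker conditions for the minimization over nonnegative \<open>a2\<close> and \<open>b\<close>: sign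
  conditions and complementary slackness.
\<close>

lemma opt_kkt:
  fixes p q k x y :: real
  assumes pos: "p > 0" "q > 0" "k > 0" and kpq: "k\<^sup>2 \<le> p * q"
  defines "\<alpha> \<equiv> opt_a p q k x y" and "\<beta> \<equiv> opt_b p q k x y"
  shows "0 \<le> \<alpha>" "0 \<le> \<beta>" "\<beta> \<le> \<bar>y\<bar> / 2"
    "p * \<bar>y\<bar> \<le> 2 * p * \<beta> + k * \<alpha>" "\<bar>x\<bar> \<le> q * \<alpha> + k * \<beta>"
    "\<beta> * (2 * p * \<beta> + k * \<alpha> - p * \<bar>y\<bar>) = 0" "\<alpha> * (q * \<alpha> + k * \<beta> - \<bar>x\<bar>) = 0"
proof -
  define X Y E where "X = \<bar>x\<bar>" and "Y = \<bar>y\<bar>" and "E = 2 * p * q - k\<^sup>2"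
  have XY: "X \<ge> 0" "Y \<ge> 0" by (auto simp: X_def Y_def)
  have E: "E > 0" using kpq pos mult_pos_pos[of p q] unfolding E_def mult.assoc by linarith
  have \<alpha>: "\<alpha> = max 0 (min (X / q) (p * (2 * X - k * Y) / E))"
    and \<beta>: "\<beta> = max 0 (min (Y / 2) ((p * q * Y - k * X) / E))"
    by (simp_all add: \<alpha>_def \<beta>_def opt_a_def opt_b_def X_def Y_def E_def)
  show "0 \<le> \<alpha>" "0 \<le> \<beta>" "\<beta> \<le> \<bar>y\<bar> / 2"
    using XY unfolding \<alpha> \<beta> Y_def[symmetric] by linarith+
  have le1: "(p * q * Y - k * X) / E \<le> Y / 2 \<longleftrightarrow> k * Y \<le> 2 * X"
  proof -
    have "(p * q * Y - k * X) / E \<le> Y / 2 \<longleftrightarrow> k * (k * Y) \<le> k * (2 * X)"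
      using E unfolding pos_divide_le_eq[OF E] by (simp add: E_def power2_eq_square algebra_simps)
    then show ?thesis using pos by simp
  qed
  have le2: "p * (2 * X - k * Y) / E \<le> X / q \<longleftrightarrow> k * X \<le> p * q * Y"
  proof -
    have "p * (2 * X - k * Y) / E \<le> X / q \<longleftrightarrow> k * (k * X) \<le> k * (p * q * Y)"
      using E pos by (simp add: divide_le_eq le_divide_eq)
         (simp add: E_def power2_eq_square algebra_simps)
    then show ?thesis using pos by (simp add: mult.assoc)
  qed
  consider "2 * X \<le> k * Y" | "p * q * Y \<le> k * X" | "k * Y < 2 * X" "k * X < p * q * Y"
    by linarith
  then have "p * Y \<le> 2 * p * \<beta> + k * \<alpha> \<and> X \<le> q * \<alpha> + k * \<beta> \<and>
    \<beta> * (2 * p * \<beta> + k * \<alpha> - p * Y) = 0 \<and> \<alpha> * (q * \<alpha> + k * \<beta> - X) = 0"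
  proof cases
    case 1
    have "p * (2 * X - k * Y) / E \<le> 0"
      using 1 pos E by (simp add: divide_nonpos_pos mult_nonneg_nonpos)
    then have "\<alpha> = 0" unfolding \<alpha> by linarith
    moreover have "\<beta> = Y / 2"
    proof (cases "k * Y = 2 * X")
      case True
      then have "(p * q * Y - k * X) / E = Y / 2"
        using E by (simp add: field_simps) (simp add: E_def power2_eq_square algebra_simps)
      then show ?thesis using XY by (simp add: \<beta>)
    next
      case False
      then have "\<not> (p * q * Y - k * X) / E \<le> Y / 2" using 1 le1 by linarith
      then show ?thesis using XY unfolding \<beta> by linarith
    qed
    ultimately have "\<alpha> = 0" "Y = 2 * \<beta>" by simp_all
    then show ?thesis using 1 by simp
  next
    case 2
    have "(p * q * Y - k * X) / E \<le> 0"
      using 2 pos E by (simp add: divide_nonpos_pos)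
    then have "\<beta> = 0" unfolding \<beta> by linarith
    moreover have "\<alpha> = X / q"
    proof (cases "p * q * Y = k * X")
      case True
      then have "p * (2 * X - k * Y) / E = X / q"
        using E pos by (simp add: field_simps) (simp add: E_def power2_eq_square algebra_simps)
      then show ?thesis using XY pos by (simp add: \<alpha>)
    next
      case False
      then have "\<not> p * (2 * X - k * Y) / E \<le> X / q" using 2 le2 by linarith
      moreover have "0 \<le> X / q" using XY pos by simp
      ultimately show ?thesis unfolding \<alpha> by linarith
    qed
    moreover have "p * Y \<le> k * (X / q)" using 2 pos by (simp add: field_simps)
    ultimately show ?thesis using pos by simp
  next
    case 3
    have "0 < p * (2 * X - k * Y) / E" "0 < (p * q * Y - k * X) / E"
      using 3 E pos by auto
    then have ab: "\<alpha> = p * (2 * X - k * Y) / E" "\<beta> = (p * q * Y - k * X) / E"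
      using le1 le2 3 unfolding \<alpha> \<beta> by linarith+
    have "2 * p * \<beta> + k * \<alpha> = p * Y * E / E"
      unfolding ab times_divide_eq_right add_divide_distrib[symmetric]
      by (simp add: E_def power2_eq_square algebra_simps)
    moreover have "q * \<alpha> + k * \<beta> = X * E / E"
      unfolding ab times_divide_eq_right add_divide_distrib[symmetric]
      by (simp add: E_def power2_eq_square algebra_simps)
    ultimately show ?thesis using E by simp
  qed
  then show "p * \<bar>y\<bar> \<le> 2 * p * \<beta> + k * \<alpha>" "\<bar>x\<bar> \<le> q * \<alpha> + k * \<beta>"
    "\<beta> * (2 * p * \<beta> + k * \<alpha> - p * \<bar>y\<bar>) = 0" "\<alpha> * (q * \<alpha> + k * \<beta> - \<bar>x\<bar>) = 0"
    by (auto simp: X_def Y_def)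
qed

lemma trial_min_le_trial:
  assumes pos: "p > 0" "q > 0" "k > 0" and kpq: "k\<^sup>2 \<le> p * q"
  shows "trial_min p q k x y \<le> trial p q k x y a1 a2 b"
proof -
  define \<alpha> \<beta> where "\<alpha> = opt_a p q k x y" and "\<beta> = opt_b p q k x y"
  note kkt = opt_kkt[OF assms, where x = x and y = y, folded \<alpha>_def \<beta>_def]
  define A B where "A = \<bar>a2\<bar>" and "B = \<bar>b\<bar>"
  have AB: "A \<ge> 0" "B \<ge> 0" by (auto simp: A_def B_def)
  have "2 * (a2 * x) \<le> 2 * (A * \<bar>x\<bar>)" "2 * (b * y) \<le> 2 * (B * \<bar>y\<bar>)"
    unfolding A_def B_def by (simp_all flip: abs_mult)
  then have "p * (y\<^sup>2 - 2 * (B * \<bar>y\<bar>) + 2 * B\<^sup>2) \<le> p * ((y - b)\<^sup>2 + b\<^sup>2)"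
    using pos by (intro mult_left_mono) (auto simp: B_def power2_diff mult.commute)
  moreover have "- (x\<^sup>2 / q) \<le> q * a1\<^sup>2 - 2 * (a1 * x)"
  proof -
    have "0 \<le> (q * a1 - x)\<^sup>2 / q" using pos by simp
    also have "\<dots> = q * a1\<^sup>2 - 2 * (a1 * x) + x\<^sup>2 / q"
      using pos by (simp add: power2_eq_square field_simps)
    finally show ?thesis by simp
  qed
  ultimately have "p * (y\<^sup>2 - 2 * (B * \<bar>y\<bar>) + 2 * B\<^sup>2) + q * A\<^sup>2 + 2 * k * (A * B) - 2 * (A * \<bar>x\<bar>) - x\<^sup>2 / q
      \<le> trial p q k x y a1 a2 b"
    using \<open>2 * (a2 * x) \<le> 2 * (A * \<bar>x\<bar>)\<close>
    by (simp add: trial_def A_def B_def abs_mult algebra_simps)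
  \<comment> \<open>Expansion around the minimizer: a quadratic form that is nonnegative because \<open>k\<^sup>2 \<le> p q\<close>,
    linear terms with nonnegative coefficients, and terms that vanish by complementary slackness.\<close>
  moreover have "p * (y\<^sup>2 - 2 * (B * \<bar>y\<bar>) + 2 * B\<^sup>2) + q * A\<^sup>2 + 2 * k * (A * B) - 2 * (A * \<bar>x\<bar>) - x\<^sup>2 / q
      - trial_min p q k x y
      = (2 * p * (B - \<beta>)\<^sup>2 + q * (A - \<alpha>)\<^sup>2 + 2 * k * ((A - \<alpha>) * (B - \<beta>)))
      + 2 * B * (2 * p * \<beta> + k * \<alpha> - p * \<bar>y\<bar>) + 2 * A * (q * \<alpha> + k * \<beta> - \<bar>x\<bar>)
      - \<beta> * (2 * p * \<beta> + k * \<alpha> - p * \<bar>y\<bar>) - \<alpha> * (q * \<alpha> + k * \<beta> - \<bar>x\<bar>)"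
    unfolding trial_min_def \<alpha>_def[symmetric] \<beta>_def[symmetric]
    by (simp add: power2_eq_square algebra_simps)
  moreover have "0 \<le> 2 * p * u\<^sup>2 + q * z\<^sup>2 + 2 * k * (z * u)" for u z
  proof -
    have "2 * p * u\<^sup>2 + q * z\<^sup>2 + 2 * k * (z * u) = ((q * z + k * u)\<^sup>2 + (2 * (p * q) - k\<^sup>2) * u\<^sup>2) / q"
      using pos by (simp add: power2_eq_square field_simps)
    moreover have "(2 * (p * q) - k\<^sup>2) * u\<^sup>2 \<ge> 0"
    proof (intro mult_nonneg_nonneg)
      show "0 \<le> 2 * (p * q) - k\<^sup>2"
        using kpq mult_pos_pos[OF pos(1,2)] by linarith
    qed simp
    ultimately show ?thesis using pos by simp
  qed
  moreover have "0 \<le> 2 * B * (2 * p * \<beta> + k * \<alpha> - p * \<bar>y\<bar>)" "0 \<le> 2 * A * (q * \<alpha> + k * \<beta> - \<bar>x\<bar>)"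
    using AB kkt by (auto intro!: mult_nonneg_nonneg)
  ultimately show ?thesis using kkt(6,7) by (smt (verit))
qed

lemma trial_min_eq_trial:
  assumes pos: "p > 0" "q > 0" "k > 0" and kpq: "k\<^sup>2 \<le> p * q"
  shows "trial_min p q k x y =
    trial p q k x y (x / q) (sgn x * opt_a p q k x y) (sgn y * opt_b p q k x y)"
proof -
  define \<alpha> \<beta> where "\<alpha> = opt_a p q k x y" and "\<beta> = opt_b p q k x y"
  note kkt = opt_kkt[OF assms, where x = x and y = y, folded \<alpha>_def \<beta>_def]
  have \<beta>0: "\<beta> = 0" if "y = 0" using kkt(2,3) that by simp
  have \<alpha>0: "\<alpha> = 0" if "x = 0"
    using pos by (simp add: \<alpha>_def opt_a_def that)
  define A B where "A = sgn x * \<alpha>" and "B = sgn y * \<beta>"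
  have eqs: "(y - B)\<^sup>2 + B\<^sup>2 = y\<^sup>2 - 2 * \<bar>y\<bar> * \<beta> + 2 * \<beta>\<^sup>2" "A\<^sup>2 = \<alpha>\<^sup>2" "A * x = \<alpha> * \<bar>x\<bar>"
      "\<bar>A * B\<bar> = \<alpha> * \<beta>"
    using \<beta>0 \<alpha>0 kkt(1,2) unfolding A_def B_def
    by (cases y "0 :: real" rule: linorder_cases; cases x "0 :: real" rule: linorder_cases;
        simp add: power2_eq_square algebra_simps abs_mult)+
  have "trial p q k x y (x / q) A B
      = p * ((y - B)\<^sup>2 + B\<^sup>2) + q * ((x / q)\<^sup>2 + A\<^sup>2) + 2 * k * \<bar>A * B\<bar>
        - 2 * (x / q * x) - 2 * (A * x)"
    by (simp add: trial_def algebra_simps)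
  also have "\<dots> = p * (y\<^sup>2 - 2 * \<bar>y\<bar> * \<beta> + 2 * \<beta>\<^sup>2) + q * ((x / q)\<^sup>2 + \<alpha>\<^sup>2) + 2 * k * (\<alpha> * \<beta>)
        - 2 * (x / q * x) - 2 * (\<alpha> * \<bar>x\<bar>)"
    unfolding eqs ..
  also have "\<dots> = p * y\<^sup>2 - x\<^sup>2 / q - p * \<bar>y\<bar> * \<beta> - \<bar>x\<bar> * \<alpha>
      + \<beta> * (2 * p * \<beta> + k * \<alpha> - p * \<bar>y\<bar>) + \<alpha> * (q * \<alpha> + k * \<beta> - \<bar>x\<bar>)"
    using pos by (simp add: power2_eq_square field_simps)
  also have "\<dots> = trial_min p q k x y"
    unfolding trial_min_def \<alpha>_def[symmetric] \<beta>_def[symmetric] using kkt(6,7) by linarith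
  finally show ?thesis by (simp add: \<alpha>_def \<beta>_def A_def B_def)
qed

section \<open>The Bellman function\<close>

text \<open>First and second derivatives of the upper support.\<close>

lemma trial_line_derivs:
  fixes P Q K P1 Q1 K1 :: "real \<Rightarrow> real" and x y d e a1 a2 b t \<kappa> \<tau> :: real
  assumes "(P has_real_derivative P1 \<tau>) (at \<tau>)" "(Q has_real_derivative Q1 \<tau>) (at \<tau>)"
    "(K has_real_derivative K1 \<tau>) (at \<tau>)"
  defines "g1 \<equiv> \<lambda>\<tau>. P1 \<tau> * ((y + \<tau> * e - b)\<^sup>2 + b\<^sup>2) + 2 * P \<tau> * (y + \<tau> * e - b) * e
      + Q1 \<tau> * ((a1 + (\<tau> - t) * \<kappa>)\<^sup>2 + a2\<^sup>2) + 2 * Q \<tau> * (a1 + (\<tau> - t) * \<kappa>) * \<kappa>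
      + 2 * K1 \<tau> * \<bar>a2 * b\<bar> - 2 * \<kappa> * (x + \<tau> * d) - 2 * (a1 + (\<tau> - t) * \<kappa> + a2) * d"
  shows "((\<lambda>\<tau>. trial (P \<tau>) (Q \<tau>) (K \<tau>) (x + \<tau> * d) (y + \<tau> * e) (a1 + (\<tau> - t) * \<kappa>) a2 b)
      has_real_derivative g1 \<tau>) (at \<tau>)"
    and "\<lbrakk>\<tau> = t; (P1 has_real_derivative P2) (at \<tau>); (Q1 has_real_derivative Q2) (at \<tau>);
        (K1 has_real_derivative K2) (at \<tau>)\<rbrakk> \<Longrightarrow>
      (g1 has_real_derivative
        P2 * ((y + t * e - b)\<^sup>2 + b\<^sup>2) + 4 * P1 t * (y + t * e - b) * e + 2 * P t * e\<^sup>2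
        + Q2 * (a1\<^sup>2 + a2\<^sup>2) + 4 * Q1 t * a1 * \<kappa> + 2 * Q t * \<kappa>\<^sup>2
        + 2 * K2 * \<bar>a2 * b\<bar> - 4 * \<kappa> * d) (at t)"
  subgoal
    unfolding trial_def g1_def
    by (rule derivative_eq_intros assms refl)+ (simp add: algebra_simps)
  subgoal
    unfolding g1_def using assms(1-3)
    by (auto intro!: derivative_eq_intros simp: power2_eq_square algebra_simps)
  done

text \<open>The function \<open>B\<close>: the minimum above with the weight functions as coefficients.\<close>

definition bellman :: "real \<Rightarrow> real \<times> real \<times> real \<times> real \<Rightarrow> real" where
  "bellman c = (\<lambda>(x, y, w, v). trial_min (wtP c w v) (wtQ c w v) (wtK c w v) x y)"

lemma wt_pos:
  assumes "c > 1" "(w, v) \<in> A2_dom c"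
  shows "0 < wtP c w v" "0 < wtQ c w v" "0 < wtK c w v"
    "(wtK c w v)\<^sup>2 \<le> wtP c w v * wtQ c w v" "wtP c w v * wtQ c w v \<le> 1 / 8"
proof -
  have "w > 0" "v > 0" using assms by (auto simp: A2_dom_def)
  moreover from this have "0 < 2 * v / (10^6 * c\<^sup>2)" using assms by simp
  ultimately show "0 < wtP c w v" "0 < wtQ c w v" "0 < wtK c w v"
    using wtP_bounds(1)[OF assms] wtQ_bounds(1)[OF assms] wtK_bounds(1)[OF assms] by linarith+
  show "(wtK c w v)\<^sup>2 \<le> wtP c w v * wtQ c w v" "wtP c w v * wtQ c w v \<le> 1 / 8"
    using wt_estimates(1,2)[OF assms] by auto
qed

lemma continuous_on_bellman:
  assumes "c > 1"
  shows "continuous_on (UNIV \<times> UNIV \<times> A2_dom c) (bellman c)"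
proof -
  let ?D = "UNIV \<times> UNIV \<times> A2_dom c :: (real \<times> real \<times> real \<times> real) set"
  define W V where "W z = fst (snd (snd z))" and "V z = snd (snd (snd z))"
    for z :: "real \<times> real \<times> real \<times> real"
  define P Q K where "P z = wtP c (W z) (V z)" and "Q z = wtQ c (W z) (V z)"
    and "K z = wtK c (W z) (V z)" for z
  have dom: "(W z, V z) \<in> A2_dom c" if "z \<in> ?D" for z
    using that by (auto simp: W_def V_def)
  have ne: "W z \<noteq> 0 \<and> V z \<noteq> 0" if "z \<in> ?D" for z
    using dom[OF that] by (auto simp: A2_dom_def)
  have c0: "c \<noteq> 0" using assms by simp
  have W: "continuous_on ?D W" and V: "continuous_on ?D V"
    unfolding W_def V_def by (intro continuous_intros)+
  have P: "continuous_on ?D P" and Q: "continuous_on ?D Q" and K: "continuous_on ?D K"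
    unfolding P_def Q_def K_def wtP_def wtQ_def wtK_def geo_def
    by (intro continuous_intros W V; use ne c0 in auto)+
  have "Q z \<noteq> 0 \<and> 2 * P z * Q z - (K z)\<^sup>2 \<noteq> 0" if "z \<in> ?D" for z
  proof -
    have "0 < P z" "0 < Q z" "(K z)\<^sup>2 \<le> P z * Q z"
      using wt_pos[OF assms dom[OF that]] by (auto simp: P_def Q_def K_def)
    moreover from this have "0 < P z * Q z" by simp
    ultimately have "2 * (P z * Q z) - (K z)\<^sup>2 > 0" by linarith
    with \<open>0 < Q z\<close> show ?thesis
      by (simp add: mult.assoc)
  qed
  then have "continuous_on ?D (\<lambda>z. trial_min (P z) (Q z) (K z) (fst z) (fst (snd z)))"
    unfolding trial_min_def opt_a_def opt_b_def
    by (intro continuous_intros P Q K) auto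
  moreover have "bellman c = (\<lambda>z. trial_min (P z) (Q z) (K z) (fst z) (fst (snd z)))"
    by (auto simp: bellman_def P_def Q_def K_def W_def V_def)
  ultimately show ?thesis by simp
qed

lemma bellman_initial:
  assumes "c > 1" "(w, v) \<in> A2_dom c" "\<bar>y\<bar> \<le> \<bar>x\<bar>"
  shows "bellman c (x, y, w, v) \<le> 0"
proof -
  define p q k where "p = wtP c w v" and "q = wtQ c w v" and "k = wtK c w v"
  note wt = wt_pos[OF assms(1,2), folded p_def q_def k_def]
  have "bellman c (x, y, w, v) \<le> trial p q k x y (x / q) 0 0"
    using trial_min_le_trial[OF wt(1-4)] by (simp add: bellman_def p_def q_def k_def)
  also have "\<dots> = (p * q * y\<^sup>2 - x\<^sup>2) / q"
    using wt(2) by (simp add: trial_def power2_eq_square field_simps)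
  also have "\<dots> \<le> 0"
  proof -
    have "p * q * y\<^sup>2 \<le> 1 * x\<^sup>2"
      using wt assms(3) by (intro mult_mono) (auto simp: abs_le_square_iff)
    then show ?thesis using wt(2) by (simp add: divide_nonpos_pos)
  qed
  finally show ?thesis .
qed

lemma bellman_majorizes:
  assumes "c > 1" "(w, v) \<in> A2_dom c"
  shows "y\<^sup>2 * w - 1000\<^sup>2 * c\<^sup>2 * x\<^sup>2 * inverse v \<le> bellman c (x, y, w, v)"
proof -
  define p q k where "p = wtP c w v" and "q = wtQ c w v" and "k = wtK c w v"
  note wt = wt_pos[OF assms, folded p_def q_def k_def]
  have wv: "w > 0" "v > 0" using assms by (auto simp: A2_dom_def)
  obtain a1 a2 b where eq: "bellman c (x, y, w, v) = trial p q k x y a1 a2 b"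
    using trial_min_eq_trial[OF wt(1-4)] by (auto simp: bellman_def p_def q_def k_def)
  have quad: "- (x\<^sup>2 / q) \<le> q * a\<^sup>2 - 2 * a * x" for a
  proof -
    have "0 \<le> (q * a - x)\<^sup>2 / q" using wt by simp
    also have "\<dots> = q * a\<^sup>2 - 2 * a * x + x\<^sup>2 / q"
      using wt by (simp add: power2_eq_square field_simps)
    finally show ?thesis by simp
  qed
  have "y\<^sup>2 * w \<le> y\<^sup>2 * (p / 2)"
    using wtP_bounds(1)[OF assms] by (intro mult_left_mono) (auto simp: p_def)
  also have "\<dots> \<le> p * ((y - b)\<^sup>2 + b\<^sup>2)"
  proof -
    have "p * ((y - b)\<^sup>2 + b\<^sup>2) - y\<^sup>2 * (p / 2) = p * ((y - 2 * b)\<^sup>2 / 2)"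
      by (simp add: power2_eq_square algebra_simps add_divide_distrib diff_divide_distrib)
    also have "\<dots> \<ge> 0" using wt by simp
    finally show ?thesis by simp
  qed
  finally have y: "y\<^sup>2 * w \<le> p * ((y - b)\<^sup>2 + b\<^sup>2)" .
  have "2 * (x\<^sup>2 / q) \<le> 2 * (x\<^sup>2 / (2 * v / (10^6 * c\<^sup>2)))"
    using wtQ_bounds(1)[OF assms] wv assms(1) wt(2)
    by (intro mult_left_mono divide_left_mono) (auto simp: q_def)
  also have "\<dots> = 1000\<^sup>2 * c\<^sup>2 * x\<^sup>2 * inverse v"
    using wv assms(1) by (simp add: field_simps)
  finally have x: "2 * (x\<^sup>2 / q) \<le> 1000\<^sup>2 * c\<^sup>2 * x\<^sup>2 * inverse v" .
  have "0 \<le> k * \<bar>a2 * b\<bar>" using wt by simp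
  with x y quad[of a1] quad[of a2] show ?thesis
    unfolding eq trial_def by (simp add: algebra_simps)
qed

lemma bellman_concave_on_lines:
  assumes c: "c > 1" and ed: "\<bar>e\<bar> \<le> \<bar>d\<bar>"
    and I: "is_interval I" "I \<subseteq> {\<tau>. (w + \<tau> * r, v + \<tau> * s) \<in> A2_dom c}"
  shows "concave_on I (\<lambda>\<tau>. bellman c (x + \<tau> * d, y + \<tau> * e, w + \<tau> * r, v + \<tau> * s))"
proof (rule concave_on_if_touched_from_above[OF I(1)])
  have "continuous_on ((\<lambda>\<tau>. (x + \<tau> * d, y + \<tau> * e, w + \<tau> * r, v + \<tau> * s)) ` I) (bellman c)"
    by (rule continuous_on_subset[OF continuous_on_bellman[OF c]]) (use I in auto)
  then show "continuous_on I (\<lambda>\<tau>. bellman c (x + \<tau> * d, y + \<tau> * e, w + \<tau> * r, v + \<tau> * s))"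
    by (rule continuous_on_compose2) (auto intro!: continuous_intros)
next
  fix t assume t: "t \<in> interior I"
  define W V where "W = (\<lambda>\<tau>. w + \<tau> * r)" and "V = (\<lambda>\<tau>. v + \<tau> * s)"
  have dom: "(W \<tau>, V \<tau>) \<in> A2_dom c" if "\<tau> \<in> interior I" for \<tau>
    using that I(2) interior_subset by (auto simp: W_def V_def)
  have pos: "W \<tau> > 0" "V \<tau> > 0" if "\<tau> \<in> interior I" for \<tau>
    using dom[OF that] by (auto simp: A2_dom_def)
  have dW: "(W has_real_derivative r) (at \<tau>)" and dV: "(V has_real_derivative s) (at \<tau>)" for \<tau>
    unfolding W_def V_def by (auto intro!: derivative_eq_intros)
  have c0: "c > 0" using c by simp
  define P Q K where "P = (\<lambda>\<tau>. wtP c (W \<tau>) (V \<tau>))" and "Q = (\<lambda>\<tau>. wtQ c (W \<tau>) (V \<tau>))"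
    and "K = (\<lambda>\<tau>. wtK c (W \<tau>) (V \<tau>))"
  define P1 Q1 K1 where "P1 = (\<lambda>\<tau>. wtP1 c (W \<tau>) (V \<tau>) r s)"
    and "Q1 = (\<lambda>\<tau>. wtP1 c (V \<tau>) (W \<tau>) s r / (10^6 * c\<^sup>2))"
    and "K1 = (\<lambda>\<tau>. wtK1 c (W \<tau>) (V \<tau>) r s)"
  define P2 Q2 K2 where "P2 = wtP2 c (W t) (V t) r s"
    and "Q2 = wtP2 c (V t) (W t) s r / (10^6 * c\<^sup>2)" and "K2 = wtK2 c (W t) (V t) r s"
  have d1: "(P has_real_derivative P1 \<tau>) (at \<tau>)" "(Q has_real_derivative Q1 \<tau>) (at \<tau>)"
    "(K has_real_derivative K1 \<tau>) (at \<tau>)" if "\<tau> \<in> interior I" for \<tau>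
    unfolding P_def Q_def K_def P1_def Q1_def K1_def wtQ_def
    by (intro wtP_has_derivative wtK_has_derivative DERIV_cdivide c0 pos[OF that] dW dV)+
  have d2: "(P1 has_real_derivative P2) (at t)" "(Q1 has_real_derivative Q2) (at t)"
    "(K1 has_real_derivative K2) (at t)"
    unfolding P2_def Q2_def K2_def P1_def Q1_def K1_def
    by (intro wtP1_has_derivative wtK1_has_derivative DERIV_cdivide c0 pos[OF t] dW dV)+
  have wt: "0 < P \<tau>" "0 < Q \<tau>" "0 < K \<tau>" "(K \<tau>)\<^sup>2 \<le> P \<tau> * Q \<tau>" "P \<tau> * Q \<tau> \<le> 1 / 8"
    if "\<tau> \<in> interior I" for \<tau>
    using wt_pos[OF c dom[OF that]] by (auto simp: P_def Q_def K_def)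
  define X Y where "X = x + t * d" and "Y = y + t * e"
  \<comment> \<open>The minimizing parameters at \<open>t\<close>; only \<open>a1\<close> will move, with the speed \<open>\<kappa>\<close>.\<close>
  define a1 a2 b where "a1 = X / Q t" and "a2 = sgn X * opt_a (P t) (Q t) (K t) X Y"
    and "b = sgn Y * opt_b (P t) (Q t) (K t) X Y"
  note kkt = opt_kkt[OF wt(1-4)[OF t], where x = X and y = Y]
  define \<kappa> where "\<kappa> = (d - a1 * Q1 t) / Q t"
  define g where "g = (\<lambda>\<tau>. trial (P \<tau>) (Q \<tau>) (K \<tau>) (x + \<tau> * d) (y + \<tau> * e) (a1 + (\<tau> - t) * \<kappa>) a2 b)"
  have a2: "\<bar>a2\<bar> = opt_a (P t) (Q t) (K t) X Y"
    using kkt(1) wt(2)[OF t] by (cases "X = 0") (auto simp: a2_def abs_mult abs_sgn_eq opt_a_def)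
  have b: "\<bar>b\<bar> = opt_b (P t) (Q t) (K t) X Y"
    using kkt(2,3) by (cases "Y = 0") (auto simp: b_def abs_mult abs_sgn_eq)
  have Yb: "\<bar>Y - b\<bar> = \<bar>Y\<bar> - \<bar>b\<bar>"
    using kkt(2,3) unfolding b unfolding b_def
    by (cases Y "0 :: real" rule: linorder_cases) auto
  have b1: "P t * \<bar>Y - b\<bar> \<le> P t * \<bar>b\<bar> + K t * \<bar>a2\<bar>"
    using kkt(4) unfolding a2[symmetric] b[symmetric] Yb by (simp add: algebra_simps)
  have a1: "Q t * \<bar>a1\<bar> \<le> Q t * \<bar>a2\<bar> + K t * \<bar>b\<bar>"
    using kkt(5) wt(2)[OF t] unfolding a2[symmetric] b[symmetric] by (simp add: a1_def)
  define g2 where "g2 = P2 * ((y + t * e - b)\<^sup>2 + b\<^sup>2) + 4 * P1 t * (y + t * e - b) * e + 2 * P t * e\<^sup>2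
        + Q2 * (a1\<^sup>2 + a2\<^sup>2) + 4 * Q1 t * a1 * \<kappa> + 2 * Q t * \<kappa>\<^sup>2
        + 2 * K2 * \<bar>a2 * b\<bar> - 4 * \<kappa> * d"
  note est = wt_estimates(3-7)[OF c dom[OF t], where r = r and s = s]
  have g2: "g2 \<le> 0"
    unfolding g2_def Y_def[symmetric] \<kappa>_def
    by (rule second_variation_nonpos[OF wt(1,2)[OF t] less_imp_le[OF wt(3)[OF t]] wt(5)[OF t]
          _ _ _ _ _ b1 a1 wt(4)[OF t] ed])
       (use est in \<open>simp_all add: P_def Q_def K_def P1_def Q1_def P2_def Q2_def K2_def\<close>)
  note der = trial_line_derivs[where P = P and Q = Q and K = K and ?P1.0 = P1 and ?Q1.0 = Q1
      and ?K1.0 = K1 and x = x and y = y and d = d and e = e and ?a1.0 = a1 and ?a2.0 = a2 and b = b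
      and t = t and \<kappa> = \<kappa>, OF d1]
  have "\<forall>\<^sub>F \<tau> in nhds t. \<tau> \<in> interior I"
    using t by (intro eventually_nhds_in_open) auto
  then have ev: "\<forall>\<^sub>F \<tau> in nhds t.
      bellman c (x + \<tau> * d, y + \<tau> * e, w + \<tau> * r, v + \<tau> * s) \<le> g \<tau> \<and> (g has_real_derivative 
        P1 \<tau> * ((y + \<tau> * e - b)\<^sup>2 + b\<^sup>2) + 2 * P \<tau> * (y + \<tau> * e - b) * e
      + Q1 \<tau> * ((a1 + (\<tau> - t) * \<kappa>)\<^sup>2 + a2\<^sup>2) + 2 * Q \<tau> * (a1 + (\<tau> - t) * \<kappa>) * \<kappa>
      + 2 * K1 \<tau> * \<bar>a2 * b\<bar> - 2 * \<kappa> * (x + \<tau> * d) - 2 * (a1 + (\<tau> - t) * \<kappa> + a2) * d) (at \<tau>)"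
  proof eventually_elim
    case (elim \<tau>)
    have "bellman c (x + \<tau> * d, y + \<tau> * e, w + \<tau> * r, v + \<tau> * s) \<le> g \<tau>"
      using trial_min_le_trial[OF wt(1-4)[OF elim]]
      by (simp add: bellman_def g_def P_def Q_def K_def W_def V_def)
    then show ?case using der(1)[OF elim elim elim] unfolding g_def by blast
  qed
  have gt: "g t = bellman c (x + t * d, y + t * e, w + t * r, v + t * s)"
    using trial_min_eq_trial[OF wt(1-4)[OF t], where x = X and y = Y]
    by (simp add: bellman_def g_def a1_def a2_def b_def X_def Y_def P_def Q_def K_def W_def V_def)
  show "\<exists>g g' g2. g t = bellman c (x + t * d, y + t * e, w + t * r, v + t * s) \<and> g2 \<le> 0 \<and>
      (g' has_real_derivative g2) (at t) \<and>
      (\<forall>\<^sub>F \<tau> in nhds t. bellman c (x + \<tau> * d, y + \<tau> * e, w + \<tau> * r, v + \<tau> * s) \<le> g \<tau> \<and>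
        (g has_real_derivative g' \<tau>) (at \<tau>))"
    using gt g2 der(2)[OF t t t refl d2, folded g2_def] ev by blast
qed

theorem theorem3p1:
  "\<exists>\<kappa> C :: real. \<kappa> > 0 \<and> C > 0 \<and>
    (\<forall>c :: real. c > 1 \<longrightarrow>
      (\<exists>B :: real \<times> real \<times> real \<times> real \<Rightarrow> real.
        continuous_on (UNIV \<times> UNIV \<times> A2_dom c) B \<and>
        (\<forall>x y w v. (w, v) \<in> A2_dom c \<and> \<bar>y\<bar> \<le> \<bar>x\<bar> \<longrightarrow> B (x, y, w, v) \<le> 0) \<and>
        (\<forall>x y w v. (w, v) \<in> A2_dom c \<longrightarrow>
          B (x, y, w, v) \<ge> \<kappa> * (y\<^sup>2 * w - C\<^sup>2 * c\<^sup>2 * x\<^sup>2 * inverse v)) \<and>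
        (\<forall>x y w v d e r s. (w, v) \<in> A2_dom c \<and> \<bar>e\<bar> \<le> \<bar>d\<bar> \<longrightarrow>
          locally_concave_on {\<tau>. (w + \<tau> * r, v + \<tau> * s) \<in> A2_dom c}
            (\<lambda>\<tau>. B (x + \<tau> * d, y + \<tau> * e, w + \<tau> * r, v + \<tau> * s)))))"
proof (rule exI[of _ 1], rule exI[of _ 1000], intro conjI allI impI)
  fix c :: real
  assume c: "c > 1"
  show "\<exists>B :: real \<times> real \<times> real \<times> real \<Rightarrow> real.
        continuous_on (UNIV \<times> UNIV \<times> A2_dom c) B \<and>
        (\<forall>x y w v. (w, v) \<in> A2_dom c \<and> \<bar>y\<bar> \<le> \<bar>x\<bar> \<longrightarrow> B (x, y, w, v) \<le> 0) \<and>
        (\<forall>x y w v. (w, v) \<in> A2_dom c \<longrightarrow>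
          B (x, y, w, v) \<ge> 1 * (y\<^sup>2 * w - 1000\<^sup>2 * c\<^sup>2 * x\<^sup>2 * inverse v)) \<and>
        (\<forall>x y w v d e r s. (w, v) \<in> A2_dom c \<and> \<bar>e\<bar> \<le> \<bar>d\<bar> \<longrightarrow>
          locally_concave_on {\<tau>. (w + \<tau> * r, v + \<tau> * s) \<in> A2_dom c}
            (\<lambda>\<tau>. B (x + \<tau> * d, y + \<tau> * e, w + \<tau> * r, v + \<tau> * s)))"
    unfolding locally_concave_on_def mult_1
    using continuous_on_bellman[OF c] bellman_initial[OF c] bellman_majorizes[OF c]
      bellman_concave_on_lines[OF c]
    by (intro exI[of _ "bellman c"]) blast
qed simp_all

end
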